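(* For every $r,k\in\mathbb{N}$ and every $\alpha>0$ there exists a constant $C=C(r,k,\alpha)$, depending only on $r,k,\alpha$, such that the following holds. Let $G$ be a finitely generated group of rank at most $r$, and let $M=(\mu_n)_{n=1}^\infty$ be a sequence of probability measures that measures index uniformly on $G$. Let $g\in G$, and suppose that $P_M^k(G,g)\ge\alpha$. Then $G$ has a $k$-step nilpotent subgroup of index at most $C$.
   Context: Groups are discrete. "$G$ has rank at most $r$" means that $G$ can be generated by at most $r$ elements. A group is $k$-step nilpotent if all $(k+1)$-fold simple commutators of its elements are trivial (nilpotent of class at most $k$), where $[x_1,x_2]=x_1^{-1}x_2^{-1}x_1x_2$ and $[x_1,\ldots,x_k]=[[x_1,\ldots,x_{k-1}],x_k]$. For a probability measure $\mu$ on $G$ and $g\in G$, $P^k_\mu(G,g)$ is the probability that $[x_1,\ldots,x_{k+1}]=g$ when $x_1,\ldots,x_{k+1}$ are chosen independently according to $\mu$. For a sequence $M=(\mu_n)_{n=1}^\infty$ of probability measures, $P_M^k(G,g)=\limsup_{n\to\infty}P_{\mu_n}^k(G,g)$. The sequence $M$ measures index uniformly if $\mu_n(xH)\to1/[G:H]$ as $n\to\infty$, uniformly over all $x\in G$ and all subgroups $H$ of $G$, where $1/[G:H]=0$ if $[G:H]=\infty$. *)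

theory Defs
  imports
    "HOL-Probability.Probability"
    "HOL-Algebra.Generated_Groups"
    "HOL-Algebra.Left_Coset"
begin

definition rank_at_most :: "('a, 'b) monoid_scheme \<Rightarrow> nat \<Rightarrow> bool" where
  "rank_at_most G r \<longleftrightarrow>
     (\<exists>S. S \<subseteq> carrier G \<and> finite S \<and> card S \<le> r \<and> generate G S = carrier G)"

definition commutator :: "('a, 'b) monoid_scheme \<Rightarrow> 'a \<Rightarrow> 'a \<Rightarrow> 'a" where
  "commutator G x y = inv\<^bsub>G\<^esub> x \<otimes>\<^bsub>G\<^esub> inv\<^bsub>G\<^esub> y \<otimes>\<^bsub>G\<^esub> x \<otimes>\<^bsub>G\<^esub> y"

text \<open>Left-normed: \<open>[x\<^sub>1, \<dots>, x\<^sub>m] = [[x\<^sub>1, \<dots>, x\<^sub>m\<^sub>-\<^sub>1], x\<^sub>m]\<close>, and \<open>[x\<^sub>1] = x\<^sub>1\<close>.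
  It is only used on nonempty lists.\<close>

definition simple_commutator :: "('a, 'b) monoid_scheme \<Rightarrow> 'a list \<Rightarrow> 'a" where
  "simple_commutator G xs = foldl (commutator G) (hd xs) (tl xs)"

definition step_nilpotent :: "nat \<Rightarrow> ('a, 'b) monoid_scheme \<Rightarrow> bool" where
  "step_nilpotent k G \<longleftrightarrow>
     (\<forall>xs. length xs = k + 1 \<and> set xs \<subseteq> carrier G \<longrightarrow> simple_commutator G xs = \<one>\<^bsub>G\<^esub>)"

definition finite_index :: "('a, 'b) monoid_scheme \<Rightarrow> 'a set \<Rightarrow> bool" where
  "finite_index G H \<longleftrightarrow> finite (lcosets\<^bsub>G\<^esub> H)"

definition group_index :: "('a, 'b) monoid_scheme \<Rightarrow> 'a set \<Rightarrow> nat" where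
  "group_index G H = card (lcosets\<^bsub>G\<^esub> H)"

text \<open>A probability measure on the discrete group \<open>G\<close> is a \<open>pmf\<close> supported in \<open>carrier G\<close>;
  for countable \<open>G\<close> (in particular for finitely generated \<open>G\<close>) these are all the
  probability measures on the power set of \<open>carrier G\<close>.\<close>

definition prob_measure_on :: "('a, 'b) monoid_scheme \<Rightarrow> 'a pmf \<Rightarrow> bool" where
  "prob_measure_on G \<mu> \<longleftrightarrow> set_pmf \<mu> \<subseteq> carrier G"

definition commutator_prob :: "nat \<Rightarrow> 'a pmf \<Rightarrow> ('a, 'b) monoid_scheme \<Rightarrow> 'a \<Rightarrow> real" where
  "commutator_prob k \<mu> G g =
     measure_pmf.prob (replicate_pmf (k + 1) \<mu>) {xs. simple_commutator G xs = g}"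

definition limsup_commutator_prob ::
    "nat \<Rightarrow> (nat \<Rightarrow> 'a pmf) \<Rightarrow> ('a, 'b) monoid_scheme \<Rightarrow> 'a \<Rightarrow> ereal" where
  "limsup_commutator_prob k M G g = limsup (\<lambda>n. ereal (commutator_prob k (M n) G g))"

text \<open>If \<open>H\<close> has infinite index then \<open>group_index G H = 0\<close>, so \<open>1 / group_index G H = 0\<close>
  because division by zero yields \<open>0\<close>; this is exactly the convention \<open>1/[G:H] = 0\<close>.\<close>

definition measures_index_uniformly ::
    "('a, 'b) monoid_scheme \<Rightarrow> (nat \<Rightarrow> 'a pmf) \<Rightarrow> bool" where
  "measures_index_uniformly G M \<longleftrightarrow>
     uniform_limit {(x, H). x \<in> carrier G \<and> subgroup H G}
       (\<lambda>n (x, H). measure_pmf.prob (M n) (x <#\<^bsub>G\<^esub> H))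
       (\<lambda>(x, H). 1 / real (group_index G H))
       sequentially"

text \<open>\<open>C\<close> bounds the index for all groups whose carrier is a set of elements of type \<open>'a\<close>.
  Type variables cannot be quantified inside a formula, so this predicate makes it possible
  to say that one constant \<open>C\<close> serves all types: choose \<open>C\<close> for the concrete type \<open>nat\<close>
  (every finitely generated group is countable, hence isomorphic to a group on a subset of
  \<open>nat\<close>), and require that any such \<open>C\<close> is valid over an arbitrary type too.\<close>

definition nilpotent_index_bound :: "'a itself \<Rightarrow> nat \<Rightarrow> nat \<Rightarrow> real \<Rightarrow> nat \<Rightarrow> bool" where
  "nilpotent_index_bound (_ :: 'a itself) r k \<alpha> C \<longleftrightarrow>
     (\<forall>(G :: 'a monoid) M g.
        group G \<and> rank_at_most G r \<and>
        (\<forall>n. prob_measure_on G (M n)) \<and> measures_index_uniformly G M \<and>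
        g \<in> carrier G \<and> limsup_commutator_prob k M G g \<ge> ereal \<alpha> \<longrightarrow>
        (\<exists>H. subgroup H G \<and> step_nilpotent k (G\<lparr>carrier := H\<rparr>) \<and>
             finite_index G H \<and> group_index G H \<le> C))"

end

theory Submission
  imports Defs "HOL-Algebra.Weak_Morphisms"
begin

text \<open>Fix \<open>c = [x\<^sub>1, \<dots>, x\<^sub>k]\<close>. The solutions \<open>x\<close> of \<open>[c, x] = g\<close> lie in one coset of the
  centralizer of \<open>c g\<close>, so a random \<open>x\<close> is a solution with probability about \<open>1/[G : C(c g)]\<close> at
  most. If \<open>[c, x] = g\<close> has probability at least \<open>\<alpha>\<close>, then with probability about \<open>\<alpha>/2\<close> the index of
  \<open>C(c g)\<close> is at most \<open>m = O(1/\<alpha>)\<close>. A group of rank \<open>r\<close> has boundedly many subgroups of index at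
  most \<open>m\<close>, so their intersection \<open>N\<close> has bounded index, is normal, and is contained in every such
  \<open>C(c g)\<close>. Hence \<open>[x\<^sub>1, \<dots>, x\<^sub>k]\<close> lies in \<open>g\<inverse> C(N)\<close> with probability at least \<open>\<alpha>/2\<close>, and by
  induction on \<open>k\<close> modulo \<open>C(N)\<close> some \<open>K\<close> of bounded index has all its \<open>k\<close>-fold simple commutators
  in \<open>C(N)\<close>. Then \<open>K \<inter> N\<close> is \<open>k\<close>-step nilpotent. For \<open>k = 0\<close> the
  hypothesis modulo \<open>L\<close> reads \<open>\<alpha> \<le> 1/[G : L]\<close>.\<close>

section \<open>Subgroups of bounded index\<close>

text \<open>The conjunct \<open>finite_index\<close> excludes subgroups of infinite index, whose
  \<open>group_index\<close> is 0 and would satisfy every bound.\<close>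

definition index_at_most :: "('a, 'b) monoid_scheme \<Rightarrow> nat \<Rightarrow> 'a set \<Rightarrow> bool" where
  "index_at_most G m H \<longleftrightarrow> subgroup H G \<and> finite_index G H \<and> group_index G H \<le> m"

lemma lcosets_eq_image: "lcosets\<^bsub>G\<^esub> H = (\<lambda>a. a <#\<^bsub>G\<^esub> H) ` carrier G"
  by (auto simp: LCOSETS_def)

context group
begin

lemma lcoset_eq_iff:
  assumes "subgroup H G" "a \<in> carrier G" "b \<in> carrier G"
  shows "a <# H = b <# H \<longleftrightarrow> inv a \<otimes> b \<in> H"
proof
  assume "a <# H = b <# H"
  then have "b \<in> a <# H" using lcos_self[OF assms(3,1)] by simp
  then show "inv a \<otimes> b \<in> H"
    using subgroup.lcos_module_imp[OF assms(1) is_group assms(2)] by blast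
next
  assume "inv a \<otimes> b \<in> H"
  then have "b \<in> a <# H"
    using subgroup.lcos_module_rev[OF assms(1) is_group assms(2,3)] by blast
  then show "a <# H = b <# H"
    using l_repr_independence[OF _ assms(2,1)] by blast
qed

lemma lcoset_eq_self_iff:
  assumes "subgroup H G" "a \<in> carrier G"
  shows "a <# H = H \<longleftrightarrow> a \<in> H"
  using assms by (metis coset_join3 lcos_self)

text \<open>The last assumption makes the coset \<open>a <# H\<close> a function of the label
  \<open>f a\<close>, so there are at most \<open>card X\<close> cosets.\<close>

lemma index_at_mostI:
  assumes "subgroup H G" "f \<in> carrier G \<rightarrow> X" "finite X" "card X \<le> m"
    and "\<And>a b. a \<in> carrier G \<Longrightarrow> b \<in> carrier G \<Longrightarrow> f a = f b \<Longrightarrow> inv a \<otimes> b \<in> H"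
  shows "index_at_most G m H"
proof -
  define g where "g = (\<lambda>y. inv_into (carrier G) f y <# H)"
  have "a <# H = g (f a)" if "a \<in> carrier G" for a
    unfolding g_def lcoset_eq_iff[OF assms(1) that inv_into_into[OF imageI[OF that]]]
    by (rule assms(5)[OF that inv_into_into[OF imageI[OF that]]])
       (simp add: f_inv_into_f that)
  then have eq: "lcosets H = g ` (f ` carrier G)"
    by (auto simp: lcosets_eq_image image_image)
  have sub: "f ` carrier G \<subseteq> X" using assms(2) by auto
  then have "finite (f ` carrier G)" using assms(3) finite_subset by blast
  moreover have "card (g ` (f ` carrier G)) \<le> m"
    using card_image_le[OF \<open>finite (f ` carrier G)\<close>, of g] card_mono[OF assms(3) sub] assms(4)
    by linarith
  ultimately show ?thesis
    using assms(1) by (simp add: index_at_most_def finite_index_def group_index_def eq)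
qed

text \<open>A coset of the intersection is determined by the corresponding cosets of all members of
  \<open>F\<close>. Nonemptiness matters because the intersection of the empty family is
  \<open>UNIV\<close>.\<close>

lemma index_at_most_Inter:
  assumes F: "finite F" "F \<noteq> {}" "\<And>H. H \<in> F \<Longrightarrow> index_at_most G m H"
  shows "index_at_most G (m ^ card F) (\<Inter> F)"
proof (rule index_at_mostI)
  show "subgroup (\<Inter> F) G"
    using subgroups_Inter[of F] F by (auto simp: index_at_most_def)
  let ?X = "PiE F (\<lambda>H. lcosets H)"
  show "(\<lambda>a. restrict (\<lambda>H. a <# H) F) \<in> carrier G \<rightarrow> ?X"
    by (auto simp: lcosets_eq_image)
  show "finite ?X"
    using F by (intro finite_PiE) (auto simp: index_at_most_def finite_index_def)
  have "card ?X = (\<Prod>H\<in>F. card (lcosets H))" using F by (simp add: card_PiE)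
  also have "\<dots> \<le> (\<Prod>H\<in>F. m)"
    by (rule prod_mono) (use F in \<open>auto simp: index_at_most_def group_index_def\<close>)
  finally show "card ?X \<le> m ^ card F" by simp
next
  fix a b assume ab: "a \<in> carrier G" "b \<in> carrier G"
    and eq: "restrict (\<lambda>H. a <# H) F = restrict (\<lambda>H. b <# H) F"
  have "inv a \<otimes> b \<in> H" if "H \<in> F" for H
    using fun_cong[OF eq, of H] that ab F(3)[OF that] by (simp add: lcoset_eq_iff index_at_most_def)
  then show "inv a \<otimes> b \<in> \<Inter> F" by blast
qed

lemma index_at_most_inter:
  assumes "index_at_most G m H" "index_at_most G n K"
  shows "index_at_most G (m * n) (H \<inter> K)"
proof (rule index_at_mostI)
  have sub: "subgroup H G" "subgroup K G" using assms by (auto simp: index_at_most_def)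
  then show "subgroup (H \<inter> K) G" using subgroups_Inter_pair by blast
  show "(\<lambda>a. (a <# H, a <# K)) \<in> carrier G \<rightarrow> (lcosets H) \<times> (lcosets K)"
    by (auto simp: lcosets_eq_image)
  show "finite ((lcosets H) \<times> (lcosets K))"
    using assms by (auto simp: index_at_most_def finite_index_def)
  show "card ((lcosets H) \<times> (lcosets K)) \<le> m * n"
    using assms by (auto simp: index_at_most_def group_index_def card_cartesian_product intro: mult_le_mono)
  show "inv a \<otimes> b \<in> H \<inter> K"
    if "a \<in> carrier G" "b \<in> carrier G" "(a <# H, a <# K) = (b <# H, b <# K)" for a b
    using that sub by (simp add: lcoset_eq_iff)
qed

lemma index_at_most_carrier: "index_at_most G 1 (carrier G)"
  by (rule index_at_mostI[where f="\<lambda>_. ()" and X="UNIV"]) (auto simp: subgroup_self)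

section \<open>Counting the subgroups of bounded index\<close>

text \<open>Agreement is preserved under composition, so it passes from the generators and their
  inverses to everything they generate. Here \<open>e\<close> and \<open>e'\<close> are meant to
  number the cosets of \<open>H\<close> and of \<open>K\<close>, and the two translation actions are
  compared through these numbers.\<close>

lemma translation_tables_agree:
  assumes H: "subgroup H G" and S: "S \<subseteq> carrier G"
    and K: "subgroup K G"
    and eq: "\<And>s a b. s \<in> S \<union> m_inv G ` S \<Longrightarrow> a \<in> carrier G \<Longrightarrow> b \<in> carrier G \<Longrightarrow>
       e (a <# H) = e' (b <# K) \<Longrightarrow> e (s \<otimes> a <# H) = e' (s \<otimes> b <# K)"
    and g: "g \<in> generate G S"
  shows "a \<in> carrier G \<Longrightarrow> b \<in> carrier G \<Longrightarrow>
       e (a <# H) = e' (b <# K) \<Longrightarrow> e (g \<otimes> a <# H) = e' (g \<otimes> b <# K)"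
  using g
proof (induction arbitrary: a b rule: generate.induct)
  case one then show ?case by simp
next
  case (incl h) then show ?case using eq by blast
next
  case (inv h) then show ?case using eq by blast
next
  case (eng h1 h2)
  have "h1 \<in> carrier G" "h2 \<in> carrier G"
    using eng.hyps generate_in_carrier[OF S] by auto
  then show ?case
    using eng.IH(1)[of "h2 \<otimes> a" "h2 \<otimes> b"] eng.IH(2)[of a b] eng.prems by (simp add: m_assoc)
qed

text \<open>A subgroup \<open>H\<close> is the stabilizer of the coset \<open>H\<close> in the left translation action on its
  cosets, and the action is determined by the permutations given by the generators.\<close>

lemma bounded_index_subgroups:
  assumes S: "S \<subseteq> carrier G" "finite S" "card S \<le> r" "generate G S = carrier G"
  shows "finite {H. index_at_most G m H} \<and> card {H. index_at_most G m H} \<le> m ^ (2 * r * m)"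
proof -
  let ?F = "{H. index_at_most G m H}"
  let ?T = "S \<union> m_inv G ` S"
  let ?X = "?T \<times> {..<m} \<rightarrow>\<^sub>E {..<m}"
  have finT: "finite ?T" using S by simp
  have cardT: "card ?T \<le> 2 * r"
    using card_Un_le[of S "m_inv G ` S"] card_image_le[OF S(2), of "m_inv G"] S(3) by linarith
  have TG: "?T \<subseteq> carrier G" using S by auto
  \<comment> \<open>The cosets are numbered below \<open>m\<close> with \<open>H\<close> itself at
    0. This common base point lets \<open>H\<close> be recovered from the numbered action as a
    stabilizer.\<close>
  have "\<exists>e. inj_on e (lcosets H) \<and> e ` (lcosets H) \<subseteq> {..<m} \<and> e H = (0::nat)" if "H \<in> ?F" for H
  proof -
    have H: "subgroup H G" "finite (lcosets H)" "card (lcosets H) \<le> m"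
      using that by (auto simp: index_at_most_def finite_index_def group_index_def)
    have HL: "H \<in> lcosets H"
      using lcoset_eq_self_iff[OF H(1) one_closed] subgroup.one_closed[OF H(1)]
      by (auto simp: lcosets_eq_image intro!: image_eqI[where x="\<one>"])
    obtain e where e: "bij_betw e (lcosets H) {..<card (lcosets H)}"
      using finite_same_card_bij[OF H(2), of "{..<card (lcosets H)}"] by auto
    \<comment> \<open>\<open>p\<close> swaps 0 with the number of \<open>H\<close>. Numbers stay
      below \<open>m\<close> because \<open>e H < card (lcosets H) \<le> m\<close>.\<close>
    define p where "p = (\<lambda>i. if i = e H then 0 else if i = 0 then e H else i)"
    have eH: "e H < card (lcosets H)" using e HL by (auto simp: bij_betw_def)
    have "inj p" by (auto simp: p_def inj_on_def split: if_splits)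
    then have "inj_on (p \<circ> e) (lcosets H)"
      using e by (intro comp_inj_on) (auto simp: bij_betw_def intro: inj_on_subset)
    moreover have "(p \<circ> e) ` (lcosets H) \<subseteq> {..<m}"
    proof clarsimp
      fix C assume "C \<in> lcosets H"
      then have "e C < card (lcosets H)" using e by (auto simp: bij_betw_def)
      then show "p (e C) < m" using eH H(3) by (auto simp: p_def)
    qed
    ultimately show ?thesis by (intro exI[of _ "p \<circ> e"]) (auto simp: p_def)
  qed
  then have "\<forall>H\<in>?F. \<exists>e. inj_on e (lcosets H) \<and> e ` (lcosets H) \<subseteq> {..<m} \<and> e H = (0::nat)"
    by (rule ballI)
  from bchoice[OF this] obtain e where
    e': "\<forall>H\<in>?F. inj_on (e H) (lcosets H) \<and> e H ` (lcosets H) \<subseteq> {..<m} \<and> e H H = (0::nat)" ..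
  have e: "inj_on (e H) (lcosets H)" "e H ` (lcosets H) \<subseteq> {..<m}" "e H H = 0"
    if "H \<in> ?F" for H using bspec[OF e' that] by auto
  \<comment> \<open>\<open>\<Phi> H\<close> is the table of the numbered action of the generators
    and their inverses. Numbers that no coset bears get the default 0, so all tables lie in the same
    finite set \<open>?X\<close>; at most \<open>2 * r\<close> translations and \<open>m\<close>
    numbers give the exponent \<open>2 * r * m\<close>.\<close>
  define \<Phi> where "\<Phi> = (\<lambda>H. restrict (\<lambda>(s, i).
     if i \<in> e H ` (lcosets H) then e H (s <# inv_into (lcosets H) (e H) i) else 0) (?T \<times> {..<m}))"
  have Phi: "\<Phi> H (s, e H (a <# H)) = e H (s \<otimes> a <# H)"
    if "H \<in> ?F" "s \<in> ?T" "a \<in> carrier G" for H s a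
  proof -
    have L: "a <# H \<in> lcosets H" using that by (auto simp: lcosets_eq_image)
    then have dom: "(s, e H (a <# H)) \<in> ?T \<times> {..<m}" using e(2)[OF that(1)] that(2) by blast
    have "H \<subseteq> carrier G" using that(1) subgroup.subset by (auto simp: index_at_most_def)
    then have assoc: "s <# (a <# H) = s \<otimes> a <# H"
      using that(2,3) TG by (intro lcos_m_assoc) blast+
    have "\<Phi> H (s, e H (a <# H)) = e H (s <# inv_into (lcosets H) (e H) (e H (a <# H)))"
      unfolding \<Phi>_def restrict_apply' [OF dom] case_prod_conv using imageI[OF L, of "e H"] by (rule if_P)
    then show ?thesis
      unfolding inv_into_f_f[OF e(1)[OF that(1)] L] assoc .
  qed
  have "\<Phi> H \<in> ?X" if "H \<in> ?F" for H
  proof (rule PiE_I)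
    fix z assume z: "z \<in> ?T \<times> {..<m}"
    then obtain s i where si: "z = (s, i)" "s \<in> ?T" "i < m" by auto
    show "\<Phi> H z \<in> {..<m}"
    proof (cases "i \<in> e H ` (lcosets H)")
      case True
      then obtain a where a: "a \<in> carrier G" "i = e H (a <# H)" by (auto simp: lcosets_eq_image)
      have "s \<otimes> a <# H \<in> lcosets H" using a si(2) TG by (auto simp: lcosets_eq_image)
      then have "e H (s \<otimes> a <# H) \<in> {..<m}" using e(2)[OF that] by blast
      then show ?thesis unfolding si(1) a(2) Phi[OF that si(2) a(1)] .
    next
      case False
      have dom: "(s, i) \<in> ?T \<times> {..<m}" using si by blast
      have "\<Phi> H (s, i) = 0"
        unfolding \<Phi>_def restrict_apply'[OF dom] case_prod_conv using False by (rule if_not_P)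
      then show ?thesis using si(1,3) by simp
    qed
  next
    show "\<Phi> H z = undefined" if "z \<notin> ?T \<times> {..<m}" for z
      unfolding \<Phi>_def using that by (rule restrict_apply[THEN trans, OF if_not_P])
  qed
  then have im: "\<Phi> ` ?F \<subseteq> ?X" by (rule image_subsetI)
  \<comment> \<open>An element of \<open>H\<close> fixes the coset numbered 0 under
    \<open>e H\<close>. If the tables are equal, it also fixes the coset numbered 0 under
    \<open>e K\<close>, which is \<open>K\<close>. By symmetry, equal tables come from equal
    subgroups.\<close>
  have sub: "H \<subseteq> K" if HK: "H \<in> ?F" "K \<in> ?F" and eq: "\<Phi> H = \<Phi> K" for H K
  proof
    have sg: "subgroup H G" "subgroup K G" using HK by (simp_all add: index_at_most_def)
    fix g assume g: "g \<in> H"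
    then have gG: "g \<in> carrier G" by (rule subgroup.mem_carrier[OF sg(1)])
    have one: "\<one> <# H = H" "\<one> <# K = K"
      using lcoset_eq_self_iff[OF sg(1) one_closed] lcoset_eq_self_iff[OF sg(2) one_closed]
        subgroup.one_closed[OF sg(1)] subgroup.one_closed[OF sg(2)] by blast+
    have "e H (g \<otimes> \<one> <# H) = e K (g \<otimes> \<one> <# K)"
    proof (rule translation_tables_agree[OF sg(1) S(1) sg(2)])
      show "e H (s \<otimes> a <# H) = e K (s \<otimes> b <# K)"
        if "s \<in> ?T" "a \<in> carrier G" "b \<in> carrier G" "e H (a <# H) = e K (b <# K)" for s a b
        unfolding Phi[OF HK(1) that(1,2), symmetric] Phi[OF HK(2) that(1,3), symmetric] that(4) eq ..
      show "g \<in> generate G S" using gG S(4) by simp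
      show "e H (\<one> <# H) = e K (\<one> <# K)"
        unfolding one e(3)[OF HK(1)] e(3)[OF HK(2)] ..
    qed simp_all
    moreover have "g <# H = H" using lcoset_eq_self_iff[OF sg(1) gG] g by simp
    ultimately have "e K (g <# K) = e K K"
      unfolding r_one[OF gG] e(3)[OF HK(2)] by (simp only: e(3)[OF HK(1)])
    moreover have "g <# K \<in> lcosets K" "K \<in> lcosets K"
      using imageI[OF gG, of "\<lambda>a. a <# K"] imageI[OF one_closed, of "\<lambda>a. a <# K"]
      unfolding lcosets_eq_image one(2) by blast+
    ultimately have "g <# K = K" by (rule inj_onD[OF e(1)[OF HK(2)]])
    then show "g \<in> K" using lcoset_eq_self_iff[OF sg(2) gG] by simp
  qed
  have inj: "inj_on \<Phi> ?F"
  proof (rule inj_onI)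
    fix H K assume "H \<in> ?F" "K \<in> ?F" "\<Phi> H = \<Phi> K"
    then show "H = K" by (intro equalityI sub) simp_all
  qed
  have finX: "finite ?X" using finT by (intro finite_PiE) auto
  have "card ?X = m ^ (card ?T * m)"
    using finT by (simp add: card_PiE card_cartesian_product)
  also have "\<dots> \<le> m ^ (2 * r * m)"
  proof (cases "m = 0")
    case False
    then show ?thesis using cardT by (intro power_increasing) auto
  qed simp
  finally show ?thesis
    using card_inj_on_le[OF inj im finX] inj_on_finite[OF inj im finX] by linarith
qed

section \<open>Conjugates and the intersection of all subgroups of bounded index\<close>

lemma index_at_most_conj:
  assumes "index_at_most G m H" "a \<in> carrier G"
  shows "index_at_most G m ((\<lambda>x. a \<otimes> x \<otimes> inv a) ` H)"
proof (rule index_at_mostI)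
  have H: "subgroup H G" using assms by (simp add: index_at_most_def)
  interpret conj: group_hom G G "\<lambda>x. a \<otimes> x \<otimes> inv a"
  proof (unfold_locales, rule homI)
    fix x y assume xy: "x \<in> carrier G" "y \<in> carrier G"
    have "a \<otimes> (x \<otimes> y) \<otimes> inv a = a \<otimes> x \<otimes> (inv a \<otimes> a) \<otimes> y \<otimes> inv a"
      using xy assms(2) by (simp add: m_assoc)
    also have "\<dots> = a \<otimes> x \<otimes> inv a \<otimes> (a \<otimes> y \<otimes> inv a)"
      using xy assms(2) by (simp only: m_assoc m_closed inv_closed)
    finally show "a \<otimes> (x \<otimes> y) \<otimes> inv a = a \<otimes> x \<otimes> inv a \<otimes> (a \<otimes> y \<otimes> inv a)" .
  qed (use assms in auto)
  show "subgroup ((\<lambda>x. a \<otimes> x \<otimes> inv a) ` H) G"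
    using H by (rule conj.subgroup_img_is_subgroup)
  \<comment> \<open>The label of \<open>x\<close> is the coset of \<open>H\<close> containing its
    pull-back under conjugation by \<open>a\<close>.\<close>
  show "(\<lambda>x. (inv a \<otimes> x \<otimes> a) <# H) \<in> carrier G \<rightarrow> lcosets H"
    using assms(2) by (auto simp: lcosets_eq_image)
  show "finite (lcosets H)" "card (lcosets H) \<le> m"
    using assms(1) by (auto simp: index_at_most_def finite_index_def group_index_def)
  fix x y assume xy: "x \<in> carrier G" "y \<in> carrier G"
    and eq: "(inv a \<otimes> x \<otimes> a) <# H = (inv a \<otimes> y \<otimes> a) <# H"
  have "inv (inv a \<otimes> x \<otimes> a) \<otimes> (inv a \<otimes> y \<otimes> a) = inv a \<otimes> inv x \<otimes> a \<otimes> (inv a \<otimes> y \<otimes> a)"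
    using xy assms(2) by (simp add: inv_mult_group m_assoc)
  also have "\<dots> = inv a \<otimes> inv x \<otimes> (a \<otimes> inv a) \<otimes> y \<otimes> a"
    using xy assms(2) by (simp only: m_assoc m_closed inv_closed)
  also have "\<dots> = inv a \<otimes> (inv x \<otimes> y) \<otimes> a"
    using xy assms(2) by (simp add: m_assoc)
  finally have "inv a \<otimes> (inv x \<otimes> y) \<otimes> a \<in> H"
    using eq xy assms(2) lcoset_eq_iff[OF H, of "inv a \<otimes> x \<otimes> a" "inv a \<otimes> y \<otimes> a"] by simp
  moreover have "a \<otimes> (inv a \<otimes> (inv x \<otimes> y) \<otimes> a) \<otimes> inv a
      = (a \<otimes> inv a) \<otimes> (inv x \<otimes> y) \<otimes> (a \<otimes> inv a)"
    using xy assms(2) by (simp only: m_assoc m_closed inv_closed)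
  then have "a \<otimes> (inv a \<otimes> (inv x \<otimes> y) \<otimes> a) \<otimes> inv a = inv x \<otimes> y"
    using xy assms(2) by simp
  ultimately show "inv x \<otimes> y \<in> (\<lambda>x. a \<otimes> x \<otimes> inv a) ` H"
    by (metis (no_types, lifting) imageI)
qed

text \<open>Conjugation permutes the subgroups of index at most \<open>m\<close>, so their
  intersection is normal. There are at most \<open>m ^ (2 * r * m)\<close> of them, and
  \<open>m > 0\<close> makes the whole group one of them, so the family is nonempty.\<close>

lemma bounded_index_core:
  assumes "rank_at_most G r" "m > 0"
  defines "N \<equiv> \<Inter> {H. index_at_most G m H}"
  shows "N \<lhd> G" "index_at_most G (m ^ (m ^ (2 * r * m))) N"
proof -
  let ?F = "{H. index_at_most G m H}"
  have fin: "finite ?F" and card: "card ?F \<le> m ^ (2 * r * m)"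
    using assms(1) bounded_index_subgroups unfolding rank_at_most_def by blast+
  have "carrier G \<in> ?F"
    using index_at_most_carrier assms(2) by (auto simp: index_at_most_def)
  then have "index_at_most G (m ^ card ?F) N"
    unfolding N_def using fin by (intro index_at_most_Inter) auto
  moreover have "m ^ card ?F \<le> m ^ (m ^ (2 * r * m))"
    using card assms(2) by (intro power_increasing) auto
  ultimately show idx: "index_at_most G (m ^ (m ^ (2 * r * m))) N"
    unfolding index_at_most_def using order_trans by blast
  show "N \<lhd> G"
    unfolding normal_inv_iff
  proof (intro conjI ballI)
    show sN: "subgroup N G" using idx by (simp add: index_at_most_def)
    fix a n assume a: "a \<in> carrier G" and n: "n \<in> N"
    have nG: "n \<in> carrier G" using subgroup.mem_carrier[OF sN n] .
    show "a \<otimes> n \<otimes> inv a \<in> N"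
      unfolding N_def
    proof (rule InterI)
      fix H assume "H \<in> ?F"
      then have sH: "subgroup H G" and "(\<lambda>x. inv a \<otimes> x \<otimes> inv (inv a)) ` H \<in> ?F"
        using index_at_most_conj[of m H "inv a"] a by (auto simp: index_at_most_def)
      then have "n \<in> (\<lambda>x. inv a \<otimes> x \<otimes> inv (inv a)) ` H" using n unfolding N_def by blast
      then obtain h where h: "h \<in> H" "n = inv a \<otimes> h \<otimes> a" using a by auto
      have hG: "h \<in> carrier G" using subgroup.mem_carrier[OF sH h(1)] .
      have "a \<otimes> n \<otimes> inv a = (a \<otimes> inv a) \<otimes> h \<otimes> (a \<otimes> inv a)"
        unfolding h(2) using a hG by (simp only: m_assoc m_closed inv_closed)
      then show "a \<otimes> n \<otimes> inv a \<in> H" using a hG h(1) by simp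
    qed
  qed
qed

end
context group
begin

section \<open>Commutators modulo a normal subgroup\<close>

lemma commutator_closed [simp]:
  "a \<in> carrier G \<Longrightarrow> b \<in> carrier G \<Longrightarrow> commutator G a b \<in> carrier G"
  by (simp add: commutator_def)

text \<open>This follows from \<open>[a, b] = (b a)^-1 (a b)\<close>. The inverse-free form says
  that conjugation by \<open>b\<close> takes \<open>a\<close> to \<open>a g\<close>.\<close>

lemma commutator_eq_iff:
  assumes "a \<in> carrier G" "b \<in> carrier G" "g \<in> carrier G"
  shows "commutator G a b = g \<longleftrightarrow> a \<otimes> b = b \<otimes> (a \<otimes> g)"
proof -
  have "commutator G a b = inv (b \<otimes> a) \<otimes> (a \<otimes> b)"
    using assms by (simp add: commutator_def inv_mult_group m_assoc)
  then have "commutator G a b = g \<longleftrightarrow> a \<otimes> b = b \<otimes> a \<otimes> g"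
    using assms inv_solve_left[of g "b \<otimes> a" "a \<otimes> b"] by auto
  then show ?thesis using assms by (simp add: m_assoc)
qed

lemma commute_inv:
  assumes "a \<in> carrier G" "b \<in> carrier G" "a \<otimes> b = b \<otimes> a"
  shows "inv a \<otimes> b = b \<otimes> inv a"
proof -
  have "inv a \<otimes> b = inv a \<otimes> (b \<otimes> a) \<otimes> inv a" using assms by (simp add: m_assoc)
  also have "\<dots> = inv a \<otimes> a \<otimes> b \<otimes> inv a"
    unfolding assms(3)[symmetric] using assms(1,2) by (simp only: m_assoc m_closed inv_closed)
  also have "\<dots> = b \<otimes> inv a" using assms(1,2) by simp
  finally show ?thesis .
qed

lemma commute_mult:
  assumes "a \<in> carrier G" "b \<in> carrier G" "c \<in> carrier G"
    and "a \<otimes> c = c \<otimes> a" "b \<otimes> c = c \<otimes> b"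
  shows "a \<otimes> b \<otimes> c = c \<otimes> (a \<otimes> b)"
  using assms by (metis m_assoc)

lemma commute_conj:
  assumes "p \<in> carrier G" "h \<in> carrier G" "a \<in> carrier G"
    and "h \<otimes> (inv p \<otimes> a \<otimes> p) = inv p \<otimes> a \<otimes> p \<otimes> h"
  shows "p \<otimes> h \<otimes> inv p \<otimes> a = a \<otimes> (p \<otimes> h \<otimes> inv p)"
proof -
  have "p \<otimes> h \<otimes> inv p \<otimes> a = p \<otimes> (h \<otimes> (inv p \<otimes> a \<otimes> p)) \<otimes> inv p"
    using assms(1-3) by (simp add: m_assoc)
  also have "\<dots> = (p \<otimes> inv p) \<otimes> a \<otimes> p \<otimes> h \<otimes> inv p"
    unfolding assms(4) using assms(1-3) by (simp only: m_assoc m_closed inv_closed)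
  also have "\<dots> = a \<otimes> (p \<otimes> h \<otimes> inv p)"
    using assms(1-3) by (simp add: m_assoc)
  finally show ?thesis .
qed

text \<open>If \<open>c\<^sup>x = c g = c\<^sup>y\<close>, then \<open>y\<inverse> x\<close> centralizes \<open>c g\<close>.\<close>

lemma commute_solutions:
  assumes "c \<in> carrier G" "g \<in> carrier G" "x \<in> carrier G" "y \<in> carrier G"
    and x: "c \<otimes> x = x \<otimes> (c \<otimes> g)" and y: "c \<otimes> y = y \<otimes> (c \<otimes> g)"
  shows "inv y \<otimes> x \<otimes> (c \<otimes> g) = c \<otimes> g \<otimes> (inv y \<otimes> x)"
proof -
  have "c \<otimes> g = inv y \<otimes> (c \<otimes> y)"
    unfolding y using assms(1-4) by (simp add: m_assoc[symmetric])
  then have "c \<otimes> g \<otimes> (inv y \<otimes> x) = inv y \<otimes> c \<otimes> (y \<otimes> inv y) \<otimes> x"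
    using assms(1-4) by (simp only: m_assoc m_closed inv_closed)
  also have "\<dots> = inv y \<otimes> (c \<otimes> x)" using assms(1-4) by (simp add: m_assoc)
  also have "\<dots> = inv y \<otimes> x \<otimes> (c \<otimes> g)" unfolding x using assms(1-4) by (simp add: m_assoc)
  finally show ?thesis ..
qed

end

lemma (in group_hom) hom_commutator:
  "a \<in> carrier G \<Longrightarrow> b \<in> carrier G \<Longrightarrow> h (commutator G a b) = commutator H (h a) (h b)"
  by (simp add: commutator_def)

text \<open>For normal \<open>L\<close> and \<open>A\<close> inside the group, this is the preimage
  in \<open>G\<close> of the centralizer of the image of \<open>A\<close> in
  \<open>G Mod L\<close>.\<close>

definition centralizer_mod :: "('a, 'b) monoid_scheme \<Rightarrow> 'a set \<Rightarrow> 'a set \<Rightarrow> 'a set" where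
  "centralizer_mod G L A = {c \<in> carrier G. \<forall>a\<in>A. commutator G c a \<in> L}"

context normal
begin

abbreviation quot :: "'a \<Rightarrow> 'a set" where "quot a \<equiv> H #> a"

lemma quot_group_hom: "group_hom G (G Mod H) quot"
  by (simp add: group_hom_def group_hom_axioms_def factorgroup_is_group r_coset_hom_Mod
      is_group)

lemma quot_closed: "a \<in> carrier G \<Longrightarrow> quot a \<in> carrier (G Mod H)"
  using group_hom.hom_closed[OF quot_group_hom] .

lemma mem_lcoset_iff_quot:
  assumes "a \<in> carrier G" "g \<in> carrier G"
  shows "a \<in> g <# H \<longleftrightarrow> quot a = quot g"
proof -
  have "a \<in> g <# H \<longleftrightarrow> a \<in> H #> g" using coset_eq assms by blast
  also have "\<dots> \<longleftrightarrow> quot a = quot g"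
    using assms repr_independence[OF _ assms(2) subgroup_axioms] rcos_self[OF assms(1) subgroup_axioms]
    by metis
  finally show ?thesis .
qed

text \<open>The quotient map turns membership in \<open>g <# H\<close> into a commutator equation in
  \<open>G Mod H\<close>, and \<open>commutator_eq_iff\<close> removes the inverses there. Facts
  about commuting elements then apply in the quotient.\<close>

lemma commutator_mem_lcoset_iff:
  assumes "a \<in> carrier G" "b \<in> carrier G" "g \<in> carrier G"
  shows "commutator G a b \<in> g <# H \<longleftrightarrow>
    quot a \<otimes>\<^bsub>G Mod H\<^esub> quot b = quot b \<otimes>\<^bsub>G Mod H\<^esub> (quot a \<otimes>\<^bsub>G Mod H\<^esub> quot g)"
  using assms by (simp only: mem_lcoset_iff_quot commutator_closed
      group_hom.hom_commutator[OF quot_group_hom]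
      group.commutator_eq_iff[OF factorgroup_is_group] quot_closed)

lemma commutator_mem_iff:
  assumes "a \<in> carrier G" "b \<in> carrier G"
  shows "commutator G a b \<in> H \<longleftrightarrow> quot a \<otimes>\<^bsub>G Mod H\<^esub> quot b = quot b \<otimes>\<^bsub>G Mod H\<^esub> quot a"
proof -
  have "\<one> <# H = H" using lcoset_eq_self_iff[OF subgroup_axioms one_closed] by simp
  moreover have "quot a \<otimes>\<^bsub>G Mod H\<^esub> quot \<one> = quot a"
    using group_hom.hom_mult[OF quot_group_hom assms(1) one_closed] assms(1) by simp
  ultimately show ?thesis
    using commutator_mem_lcoset_iff[OF assms one_closed] by simp
qed

lemma centralizer_mod_subgroup:
  assumes "A \<subseteq> carrier G"
  shows "subgroup (centralizer_mod G H A) G"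
proof -
  interpret q: group_hom G "G Mod H" quot by (rule quot_group_hom)
  have iff: "c \<in> centralizer_mod G H A \<longleftrightarrow>
      c \<in> carrier G \<and> (\<forall>a\<in>A. quot c \<otimes>\<^bsub>G Mod H\<^esub> quot a = quot a \<otimes>\<^bsub>G Mod H\<^esub> quot c)" for c
    using assms commutator_mem_iff by (fastforce simp: centralizer_mod_def)
  show ?thesis
  proof (rule subgroupI)
    show "centralizer_mod G H A \<subseteq> carrier G" by (auto simp: iff)
    have "\<one> \<in> centralizer_mod G H A"
      unfolding iff using assms q.hom_mult[OF one_closed] q.hom_mult[OF _ one_closed]
      by (metis l_one r_one one_closed subsetD)
    then show "centralizer_mod G H A \<noteq> {}" by blast
  next
    fix c assume "c \<in> centralizer_mod G H A"
    then show "inv c \<in> centralizer_mod G H A"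
      using assms q.H.commute_inv[of "quot c"] by (auto simp: iff q.hom_inv subset_iff simp del: q.hom_mult)
  next
    fix c d assume "c \<in> centralizer_mod G H A" "d \<in> centralizer_mod G H A"
    then show "c \<otimes> d \<in> centralizer_mod G H A"
      unfolding iff
    proof (intro conjI ballI)
      fix a assume cd: "c \<in> carrier G \<and> (\<forall>a\<in>A. quot c \<otimes>\<^bsub>G Mod H\<^esub> quot a = quot a \<otimes>\<^bsub>G Mod H\<^esub> quot c)"
        "d \<in> carrier G \<and> (\<forall>a\<in>A. quot d \<otimes>\<^bsub>G Mod H\<^esub> quot a = quot a \<otimes>\<^bsub>G Mod H\<^esub> quot d)"
        and a: "a \<in> A"
      then have cl: "quot c \<in> carrier (G Mod H)" "quot d \<in> carrier (G Mod H)" "quot a \<in> carrier (G Mod H)"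
        using assms quot_closed by blast+
      have "quot c \<otimes>\<^bsub>G Mod H\<^esub> quot d \<otimes>\<^bsub>G Mod H\<^esub> quot a = quot a \<otimes>\<^bsub>G Mod H\<^esub> (quot c \<otimes>\<^bsub>G Mod H\<^esub> quot d)"
        using cd a by (intro q.H.commute_mult[OF cl]) blast+
      then show "quot (c \<otimes> d) \<otimes>\<^bsub>G Mod H\<^esub> quot a = quot a \<otimes>\<^bsub>G Mod H\<^esub> quot (c \<otimes> d)"
        using cd q.hom_mult by simp
    qed auto
  qed
qed

text \<open>Modulo \<open>H\<close>, the element \<open>p c p^-1\<close> commutes with
  \<open>a\<close> as soon as \<open>c\<close> commutes with \<open>p^-1 a p\<close>, which lies in
  \<open>A\<close> again.\<close>

lemma centralizer_mod_normal:
  assumes "A \<lhd> G"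
  shows "centralizer_mod G H A \<lhd> G"
  unfolding normal_inv_iff
proof (intro conjI ballI)
  interpret q: group_hom G "G Mod H" quot by (rule quot_group_hom)
  have A: "A \<subseteq> carrier G" using assms normal_imp_subgroup subgroup.subset by blast
  show "subgroup (centralizer_mod G H A) G" by (rule centralizer_mod_subgroup[OF A])
  fix p c assume p: "p \<in> carrier G" and "c \<in> centralizer_mod G H A"
  then have c: "c \<in> carrier G" "\<And>a. a \<in> A \<Longrightarrow> commutator G c a \<in> H"
    by (auto simp: centralizer_mod_def)
  have "commutator G (p \<otimes> c \<otimes> inv p) a \<in> H" if a: "a \<in> A" for a
  proof -
    have aG: "a \<in> carrier G" using a A by blast
    have "inv p \<otimes> a \<otimes> inv (inv p) \<in> A"
      using assms p a unfolding normal_inv_iff by (meson inv_closed)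
    then have "inv p \<otimes> a \<otimes> p \<in> A" using p by simp
    then have "quot c \<otimes>\<^bsub>G Mod H\<^esub> quot (inv p \<otimes> a \<otimes> p) = quot (inv p \<otimes> a \<otimes> p) \<otimes>\<^bsub>G Mod H\<^esub> quot c"
      using c p aG by (subst commutator_mem_iff[symmetric]) auto
    then have "quot (p \<otimes> c \<otimes> inv p) \<otimes>\<^bsub>G Mod H\<^esub> quot a = quot a \<otimes>\<^bsub>G Mod H\<^esub> quot (p \<otimes> c \<otimes> inv p)"
      using q.H.commute_conj[of "quot p" "quot c" "quot a"] p c(1) aG quot_closed
      by (simp only: q.hom_mult q.hom_inv inv_closed m_closed)
    then show ?thesis using commutator_mem_iff p c(1) aG by simp
  qed
  then show "p \<otimes> c \<otimes> inv p \<in> centralizer_mod G H A"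
    using p c(1) by (simp add: centralizer_mod_def)
qed

text \<open>Modulo \<open>H\<close>, both \<open>x\<close> and \<open>y\<close> conjugate
  \<open>c\<close> to \<open>c g\<close>, so \<open>y^-1 x\<close> centralizes \<open>c g\<close>.
  All solutions thus lie in one coset, whose probability is governed by the index of the
  centralizer.\<close>

lemma commutator_lcoset_fibre:
  assumes "c \<in> carrier G" "g \<in> carrier G" "y \<in> carrier G" "commutator G c y \<in> g <# H"
    and "x \<in> carrier G" "commutator G c x \<in> g <# H"
  shows "x \<in> y <# centralizer_mod G H {c \<otimes> g}"
proof -
  interpret q: group_hom G "G Mod H" quot by (rule quot_group_hom)
  have "quot (inv y \<otimes> x) \<otimes>\<^bsub>G Mod H\<^esub> quot (c \<otimes> g) = quot (c \<otimes> g) \<otimes>\<^bsub>G Mod H\<^esub> quot (inv y \<otimes> x)"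
    using q.H.commute_solutions[of "quot c" "quot g" "quot x" "quot y"] assms
      commutator_mem_lcoset_iff quot_closed
    by (simp only: q.hom_mult q.hom_inv inv_closed m_closed)
  then have "inv y \<otimes> x \<in> centralizer_mod G H {c \<otimes> g}"
    using assms commutator_mem_iff by (simp add: centralizer_mod_def)
  then show ?thesis
    using subgroup.lcos_module_rev[OF centralizer_mod_subgroup is_group] assms by auto
qed

end

section \<open>The probabilistic step\<close>

lemma measure_bind_pmf:
  "measure_pmf.prob (bind_pmf p f) A = (\<integral>x. measure_pmf.prob (f x) A \<partial>measure_pmf p)"
  unfolding measure_pmf_bind
  by (rule measure_pmf.measure_bind[where N="count_space UNIV"])
    (auto simp: measure_pmf_in_subprob_algebra)

text \<open>The inner probability is at most 1 on \<open>B\<close> and at most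
  \<open>\<epsilon>\<close> off \<open>B\<close>; integrating gives the bound.\<close>

lemma prob_bind_pmf_le:
  assumes "\<And>x. x \<in> set_pmf p \<Longrightarrow> x \<notin> B \<Longrightarrow> measure_pmf.prob (f x) A \<le> \<epsilon>" "\<epsilon> \<ge> 0"
  shows "measure_pmf.prob (bind_pmf p f) A \<le> measure_pmf.prob p B + \<epsilon>"
proof -
  have ind: "integrable (measure_pmf p) (indicator B :: _ \<Rightarrow> real)"
    by (rule measure_pmf.integrable_const_bound[where B=1]) (auto simp: indicator_def)
  then have int: "integrable (measure_pmf p) (\<lambda>x. indicator B x + \<epsilon> :: real)"
    by simp
  have "measure_pmf.prob (bind_pmf p f) A \<le> (\<integral>x. indicator B x + \<epsilon> \<partial>measure_pmf p)"
    unfolding measure_bind_pmf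
  proof (rule integral_mono_AE[OF _ int])
    show "integrable (measure_pmf p) (\<lambda>x. measure_pmf.prob (f x) A)"
      by (rule measure_pmf.integrable_const_bound[where B=1]) (auto simp: measure_pmf.prob_le_1)
    show "AE x in measure_pmf p. measure_pmf.prob (f x) A \<le> indicator B x + \<epsilon>"
      unfolding AE_measure_pmf_iff
    proof
      fix x assume "x \<in> set_pmf p"
      moreover have "measure_pmf.prob (f x) A \<le> 1" by (rule measure_pmf.prob_le_1)
      ultimately show "measure_pmf.prob (f x) A \<le> indicator B x + \<epsilon>"
        using assms by (cases "x \<in> B") (auto intro: order_trans)
    qed
  qed
  also have "\<dots> = measure_pmf.prob p B + \<epsilon>"
    using ind by (subst Bochner_Integration.integral_add) auto
  finally show ?thesis .
qed

text \<open>\<open>replicate_pmf\<close> unfolds at the head, whereas left-normed commutators grow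
  at the end, so the last entry has to be split off.\<close>

lemma replicate_pmf_snoc:
  "replicate_pmf (n + 1) p = bind_pmf (replicate_pmf n p) (\<lambda>xs. map_pmf (\<lambda>x. xs @ [x]) p)"
  unfolding replicate_pmf_distrib replicate_pmf_1
  by (simp add: map_pmf_def bind_assoc_pmf bind_return_pmf)

lemma simple_commutator_snoc:
  "xs \<noteq> [] \<Longrightarrow> simple_commutator G (xs @ [x]) = commutator G (simple_commutator G xs) x"
  by (cases xs) (simp_all add: simple_commutator_def)

lemma (in group) simple_commutator_closed:
  "xs \<noteq> [] \<Longrightarrow> set xs \<subseteq> carrier G \<Longrightarrow> simple_commutator G xs \<in> carrier G"
proof (induction xs rule: rev_induct)
  case (snoc x xs)
  then show ?case
    by (cases "xs = []") (simp_all add: simple_commutator_snoc, simp add: simple_commutator_def)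
qed simp

text \<open>One \<open>n\<close> serves all cosets of all subgroups at once. This matters because
  the bound is applied to centralizers that depend on a random commutator.\<close>

lemma measures_index_uniformlyD:
  assumes "measures_index_uniformly G M" "\<epsilon> > 0"
  shows "\<forall>\<^sub>F n in sequentially. \<forall>x\<in>carrier G. \<forall>H. subgroup H G \<longrightarrow>
    measure_pmf.prob (M n) (x <#\<^bsub>G\<^esub> H) \<le> 1 / real (group_index G H) + \<epsilon>"
  using uniform_limitD[OF assms(1)[unfolded measures_index_uniformly_def] assms(2)]
  by eventually_elim (force simp: dist_real_def)

text \<open>Fix the first \<open>k + 1\<close> entries and let \<open>c\<close> be their commutator.
  If \<open>c\<close> is outside \<open>inv g <# centralizer_mod G H N\<close>, the centralizer of
  \<open>c g\<close> modulo \<open>H\<close> does not have index at most \<open>m\<close>, since it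
  would then contain \<open>N\<close>. So the last entry solves the equation with probability at
  most \<open>1 / m + \<epsilon>\<close>.\<close>

lemma (in normal) prob_simple_commutator_step:
  fixes p :: "'a pmf"
  assumes p: "set_pmf p \<subseteq> carrier G" and g: "g \<in> carrier G" and m: "m > 0"
    and N: "N \<lhd> G" "\<And>K. index_at_most G m K \<Longrightarrow> N \<subseteq> K"
    and unif: "\<And>x K. x \<in> carrier G \<Longrightarrow> subgroup K G \<Longrightarrow>
      measure_pmf.prob p (x <# K) \<le> 1 / real (group_index G K) + \<epsilon>" and "\<epsilon> \<ge> 0"
  shows "measure_pmf.prob (replicate_pmf (Suc k + 1) p) {xs. simple_commutator G xs \<in> g <# H}
    \<le> measure_pmf.prob (replicate_pmf (k + 1) p)
        {xs. simple_commutator G xs \<in> inv g <# centralizer_mod G H N} + (1 / real m + \<epsilon>)"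
proof -
  let ?Z = "centralizer_mod G H"
  have NG: "N \<subseteq> carrier G" using N(1) normal_imp_subgroup subgroup.subset by blast
  have Z: "?Z N \<lhd> G" using centralizer_mod_normal[OF N(1)] .
  have "measure_pmf.prob (map_pmf (\<lambda>x. xs @ [x]) p) {xs. simple_commutator G xs \<in> g <# H} \<le> 1 / real m + \<epsilon>"
    if xs: "xs \<in> set_pmf (replicate_pmf (k + 1) p)"
      and out: "xs \<notin> {xs. simple_commutator G xs \<in> inv g <# ?Z N}" for xs
  proof -
    define c where "c = simple_commutator G xs"
    have xs': "xs \<noteq> []" "set xs \<subseteq> set_pmf p" using xs by (auto simp: set_replicate_pmf)
    then have xs': "xs \<noteq> []" "set xs \<subseteq> carrier G" using p by auto
    then have c: "c \<in> carrier G" unfolding c_def by (rule simple_commutator_closed)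
    have prob: "measure_pmf.prob (map_pmf (\<lambda>x. xs @ [x]) p) {xs. simple_commutator G xs \<in> g <# H}
        = measure_pmf.prob p {x. commutator G c x \<in> g <# H}"
      using xs'(1) by (simp add: vimage_def simple_commutator_snoc c_def)
    show ?thesis
    proof (cases "\<exists>y\<in>carrier G. commutator G c y \<in> g <# H")
      case False
      then have "measure_pmf.prob p {x. commutator G c x \<in> g <# H} = 0"
        using p by (subst measure_pmf.prob_eq_0) (auto simp: AE_measure_pmf_iff)
      then show ?thesis using prob \<open>\<epsilon> \<ge> 0\<close> by simp
    next
      case True
      then obtain y where y: "y \<in> carrier G" "commutator G c y \<in> g <# H" by blast
      let ?D = "?Z {c \<otimes> g}"
      have D: "subgroup ?D G" using c g by (intro centralizer_mod_subgroup) auto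
      have "\<not> index_at_most G m ?D"
      proof
        assume "index_at_most G m ?D"
        then have "N \<subseteq> ?D" by (rule N(2))
        \<comment> \<open>Commuting modulo \<open>H\<close> is symmetric: if \<open>N\<close>
          centralizes \<open>c g\<close> modulo \<open>H\<close>, then \<open>c g\<close>
          centralizes \<open>N\<close>.\<close>
        then have "commutator G (c \<otimes> g) x \<in> H" if "x \<in> N" for x
          using that c g NG commutator_mem_iff[of x "c \<otimes> g"] commutator_mem_iff[of "c \<otimes> g" x]
          by (fastforce simp: centralizer_mod_def)
        then have "c \<otimes> g \<in> ?Z N" using c g by (simp add: centralizer_mod_def)
        \<comment> \<open>Conjugating \<open>c g\<close> by \<open>g\<close> gives
          \<open>g c\<close>, so normality of \<open>?Z N\<close> places \<open>c\<close> in the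
          left coset of \<open>inv g\<close>.\<close>
        then have "g \<otimes> (c \<otimes> g) \<otimes> inv g \<in> ?Z N" using Z g unfolding normal_inv_iff by blast
        then have "inv (inv g) \<otimes> c \<in> ?Z N" using c g by (simp add: m_assoc)
        then have "c \<in> inv g <# ?Z N"
          using subgroup.lcos_module_rev[OF normal_imp_subgroup[OF Z] is_group] c g by blast
        then show False using out by (simp add: c_def)
      qed
      \<comment> \<open>For infinite index the left side is \<open>1 / 0 = 0\<close>; otherwise the
        index exceeds \<open>m\<close>.\<close>
      then have "1 / real (group_index G ?D) \<le> 1 / real m"
        using D m by (cases "finite_index G ?D")
          (auto simp: index_at_most_def finite_index_def group_index_def intro!: divide_left_mono)
      moreover have "measure_pmf.prob p {x. commutator G c x \<in> g <# H} \<le> measure_pmf.prob p (y <# ?D)"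
        using p commutator_lcoset_fibre[OF c g y]
        by (intro measure_pmf.finite_measure_mono_AE) (auto simp: AE_measure_pmf_iff)
      ultimately show ?thesis using prob unif[OF y(1) D] by linarith
    qed
  qed
  then show ?thesis
    unfolding Suc_eq_plus1[of k] replicate_pmf_snoc[of "k + 1"]
    using \<open>\<epsilon> \<ge> 0\<close> by (intro prob_bind_pmf_le) auto
qed

section \<open>The index bound\<close>

text \<open>For \<open>k = 0\<close>, an error of \<open>\<alpha> / 2\<close> in the measure of a
  coset leaves \<open>\<alpha> / 2 \<le> 1 / [G : L]\<close>. In the recursion, \<open>1 / m\<close>
  and an error of \<open>\<alpha> / 4\<close> together cost at most \<open>\<alpha> / 2\<close>, and
  the second factor bounds the index of the intersection of all subgroups of index at most
  \<open>m\<close>.\<close>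

fun nilpotency_bound :: "nat \<Rightarrow> nat \<Rightarrow> real \<Rightarrow> nat" where
  "nilpotency_bound r 0 \<alpha> = nat \<lceil>2 / \<alpha>\<rceil>"
| "nilpotency_bound r (Suc k) \<alpha> =
    (let m = nat \<lceil>4 / \<alpha>\<rceil> in nilpotency_bound r k (\<alpha> / 2) * m ^ (m ^ (2 * r * m)))"

text \<open>Working modulo a normal subgroup \<open>L\<close> and with an arbitrary target coset \<open>g L\<close> takes the
  place of passing to quotient groups, whose elements would have a different type.\<close>

lemma (in group) simple_commutators_in_normal_subgroup:
  assumes rank: "rank_at_most G r" and M: "\<And>n. prob_measure_on G (M n)"
    and unif: "measures_index_uniformly G M"
    and "L \<lhd> G" "g \<in> carrier G" "\<alpha> > 0"
    and "\<exists>\<^sub>F n in sequentially. \<alpha> \<le> measure_pmf.prob (replicate_pmf (k + 1) (M n))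
           {xs. simple_commutator G xs \<in> g <# L}"
  shows "\<exists>K. index_at_most G (nilpotency_bound r k \<alpha>) K \<and>
    (\<forall>xs. length xs = k + 1 \<and> set xs \<subseteq> K \<longrightarrow> simple_commutator G xs \<in> L)"
  using assms(4-7)
proof (induction k arbitrary: L g \<alpha>)
  case 0
  have L: "subgroup L G" using 0(1) normal_imp_subgroup by blast
  have "measure_pmf.prob (replicate_pmf (0 + 1) p) {xs. simple_commutator G xs \<in> g <# L}
      = measure_pmf.prob p (g <# L)" for p
    unfolding add_0 replicate_pmf_1 by (simp add: vimage_def simple_commutator_def)
  then have "\<exists>\<^sub>F n in sequentially. \<alpha> \<le> measure_pmf.prob (M n) (g <# L)"
    using 0(4) by simp
  from frequently_eventually_frequently[OF this measures_index_uniformlyD[OF unif half_gt_zero[OF 0(3)]]]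
  obtain n where "\<alpha> \<le> measure_pmf.prob (M n) (g <# L)"
    "measure_pmf.prob (M n) (g <# L) \<le> 1 / real (group_index G L) + \<alpha> / 2"
    using 0(2) L by (auto dest!: frequently_ex)
  then have le: "\<alpha> / 2 \<le> 1 / real (group_index G L)" by linarith
  \<comment> \<open>This is where infinite index is ruled out: index value 0 would give
    \<open>\<alpha> / 2 \<le> 1 / 0 = 0\<close>.\<close>
  then have pos: "group_index G L > 0" using 0(3) by (cases "group_index G L = 0") auto
  then have "real (group_index G L) \<le> 2 / \<alpha>" using le 0(3) by (simp add: field_simps)
  then have "group_index G L \<le> nat \<lceil>2 / \<alpha>\<rceil>" by linarith
  moreover have "finite_index G L"
    using pos by (simp add: finite_index_def group_index_def card_gt_0_iff)
  ultimately have "index_at_most G (nilpotency_bound r 0 \<alpha>) L"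
    using L by (simp add: index_at_most_def)
  \<comment> \<open>\<open>L\<close> itself serves as the subgroup, because a commutator with one
    entry is that entry.\<close>
  then show ?case
    by (intro exI[of _ L]) (auto simp: length_Suc_conv simple_commutator_def)
next
  case (Suc k)
  interpret L: normal L G by (rule Suc.prems(1))
  define m where "m = nat \<lceil>4 / \<alpha>\<rceil>"
  have "4 / \<alpha> > 0" using Suc.prems(3) by simp
  then have m: "m > 0" "4 / \<alpha> \<le> real m" unfolding m_def by linarith+
  then have inv_m: "1 / real m \<le> \<alpha> / 4" using Suc.prems(3) by (simp add: field_simps)
  define N where "N = \<Inter> {H. index_at_most G m H}"
  have N: "N \<lhd> G" "index_at_most G (m ^ (m ^ (2 * r * m))) N"
    unfolding N_def using bounded_index_core[OF rank m(1)] by auto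
  let ?Z = "centralizer_mod G L N"
  \<comment> \<open>Uniformity with error \<open>\<alpha> / 4\<close> holds for all large
    \<open>n\<close>, hence infinitely often together with the hypothesis. For such \<open>n\<close>
    the probability drops by at most \<open>1 / m + \<alpha> / 4 \<le> \<alpha> / 2\<close>.\<close>
  have "\<exists>\<^sub>F n in sequentially. \<alpha> / 2 \<le> measure_pmf.prob (replicate_pmf (k + 1) (M n))
           {xs. simple_commutator G xs \<in> inv g <# ?Z}"
  proof (rule frequently_elim1[OF frequently_eventually_frequently[OF Suc.prems(4)
        measures_index_uniformlyD[OF unif, of "\<alpha> / 4"]]])
    show "\<alpha> / 4 > 0" using Suc.prems(3) by simp
    fix n
    assume n: "\<alpha> \<le> measure_pmf.prob (replicate_pmf (Suc k + 1) (M n)) {xs. simple_commutator G xs \<in> g <# L} \<and>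
      (\<forall>x\<in>carrier G. \<forall>H. subgroup H G \<longrightarrow>
         measure_pmf.prob (M n) (x <# H) \<le> 1 / real (group_index G H) + \<alpha> / 4)"
    have "measure_pmf.prob (replicate_pmf (Suc k + 1) (M n)) {xs. simple_commutator G xs \<in> g <# L}
      \<le> measure_pmf.prob (replicate_pmf (k + 1) (M n)) {xs. simple_commutator G xs \<in> inv g <# ?Z}
        + (1 / real m + \<alpha> / 4)"
    proof (rule L.prob_simple_commutator_step[OF _ Suc.prems(2) m(1) N(1)])
      show "set_pmf (M n) \<subseteq> carrier G" using M by (simp add: prob_measure_on_def)
      show "N \<subseteq> K" if "index_at_most G m K" for K using that by (auto simp: N_def)
    qed (use n Suc.prems(3) in auto)
    then show "\<alpha> / 2 \<le> measure_pmf.prob (replicate_pmf (k + 1) (M n)) {xs. simple_commutator G xs \<in> inv g <# ?Z}"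
      using n inv_m by linarith
  qed
  \<comment> \<open>The induction hypothesis is used modulo \<open>?Z\<close>, with target
    \<open>inv g\<close> and probability \<open>\<alpha> / 2\<close>.\<close>
  then obtain K where K: "index_at_most G (nilpotency_bound r k (\<alpha> / 2)) K"
    "\<And>xs. length xs = k + 1 \<Longrightarrow> set xs \<subseteq> K \<Longrightarrow> simple_commutator G xs \<in> ?Z"
    using Suc.IH[OF L.centralizer_mod_normal[OF N(1)] inv_closed[OF Suc.prems(2)] half_gt_zero[OF Suc.prems(3)]]
    by blast
  \<comment> \<open>Membership in \<open>K\<close> puts the commutator of the initial entries into
    \<open>?Z\<close>; membership of the last entry in \<open>N\<close> then puts the full
    commutator into \<open>L\<close>.\<close>
  have "simple_commutator G xs \<in> L" if len: "length xs = Suc k + 1" and sub: "set xs \<subseteq> K \<inter> N" for xs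
  proof -
    obtain ys x where xs: "xs = ys @ [x]" "length ys = k + 1"
      using len by (metis add.commute length_Suc_conv_rev plus_1_eq_Suc)
    then have "simple_commutator G ys \<in> ?Z" "x \<in> N" "ys \<noteq> []" using K(2)[of ys] sub by auto
    then show ?thesis by (simp add: xs(1) simple_commutator_snoc centralizer_mod_def)
  qed
  moreover have "index_at_most G (nilpotency_bound r (Suc k) \<alpha>) (K \<inter> N)"
    using index_at_most_inter[OF K(1) N(2)] by (simp add: m_def Let_def)
  ultimately show ?case by blast
qed

text \<open>Inverses in the restricted structure are known to agree with those of \<open>G\<close>
  for elements of \<open>H\<close>, so the induction also needs each initial commutator to lie in
  \<open>H\<close>.\<close>

lemma (in group) step_nilpotent_subgroup_iff:
  assumes "subgroup H G"
  shows "step_nilpotent k (G\<lparr>carrier := H\<rparr>) \<longleftrightarrow>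
    (\<forall>xs. length xs = k + 1 \<and> set xs \<subseteq> H \<longrightarrow> simple_commutator G xs = \<one>)"
proof -
  interpret H: group "G\<lparr>carrier := H\<rparr>" by (rule subgroup.subgroup_is_group[OF assms is_group])
  have "simple_commutator (G\<lparr>carrier := H\<rparr>) xs = simple_commutator G xs"
    if "xs \<noteq> []" "set xs \<subseteq> H" for xs
    using that
  proof (induction xs rule: rev_induct)
    case (snoc x xs)
    show ?case
    proof (cases "xs = []")
      case False
      then have "simple_commutator (G\<lparr>carrier := H\<rparr>) xs \<in> H"
        using H.simple_commutator_closed[of xs] snoc.prems by simp
      then show ?thesis
        using False snoc assms by (simp add: simple_commutator_snoc commutator_def)
    qed (simp add: simple_commutator_def)
  qed simp
  then have "simple_commutator (G\<lparr>carrier := H\<rparr>) xs = simple_commutator G xs"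
    if "length xs = k + 1" "set xs \<subseteq> H" for xs
    using that by (metis add_is_0 list.size(3) one_neq_zero)
  then show ?thesis by (auto simp: step_nilpotent_def)
qed

text \<open>Take the trivial subgroup for \<open>L\<close>. A limsup of at least
  \<open>\<alpha>\<close> need not be attained, but it forces values of at least
  \<open>\<alpha> / 2\<close> infinitely often; hence the argument
  \<open>\<alpha> / 2\<close>.\<close>

lemma nilpotent_index_bound_nilpotency_bound:
  assumes "\<alpha> > 0"
  shows "nilpotent_index_bound TYPE('a) r k \<alpha> (nilpotency_bound r k (\<alpha> / 2))"
  unfolding nilpotent_index_bound_def
proof (intro allI impI)
  fix G :: "'a monoid" and M g
  assume *: "group G \<and> rank_at_most G r \<and>
        (\<forall>n. prob_measure_on G (M n)) \<and> measures_index_uniformly G M \<and>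
        g \<in> carrier G \<and> limsup_commutator_prob k M G g \<ge> ereal \<alpha>"
  then interpret group G by simp
  have g: "g \<in> carrier G" using * by simp
  have "\<exists>\<^sub>F n in sequentially. \<alpha> / 2 \<le> commutator_prob k (M n) G g"
  proof (rule ccontr)
    assume "\<not> ?thesis"
    then have "\<forall>\<^sub>F n in sequentially. ereal (commutator_prob k (M n) G g) \<le> ereal (\<alpha> / 2)"
      by (auto simp: not_frequently not_le elim: eventually_mono)
    then have "limsup_commutator_prob k M G g \<le> ereal (\<alpha> / 2)"
      unfolding limsup_commutator_prob_def by (rule Limsup_bounded)
    then have "ereal \<alpha> \<le> ereal (\<alpha> / 2)" using * order_trans by blast
    then show False using assms by simp
  qed
  moreover have "g <#\<^bsub>G\<^esub> {\<one>\<^bsub>G\<^esub>} = {g}" using g by (simp add: l_coset_def)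
  ultimately obtain K where K: "index_at_most G (nilpotency_bound r k (\<alpha> / 2)) K"
    "\<forall>xs. length xs = k + 1 \<and> set xs \<subseteq> K \<longrightarrow> simple_commutator G xs \<in> {\<one>\<^bsub>G\<^esub>}"
    using simple_commutators_in_normal_subgroup[of r M "{\<one>\<^bsub>G\<^esub>}" g "\<alpha> / 2" k] * assms one_is_normal
    by (auto simp: commutator_prob_def)
  then show "\<exists>H. subgroup H G \<and> step_nilpotent k (G\<lparr>carrier := H\<rparr>) \<and>
             finite_index G H \<and> group_index G H \<le> nilpotency_bound r k (\<alpha> / 2)"
    using step_nilpotent_subgroup_iff by (auto simp: index_at_most_def)
qed

section \<open>Transport to groups of natural numbers\<close>

text \<open>Every element is the product of a finite word in the generators and their inverses, and
  there are countably many words over a finite alphabet.\<close>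

lemma (in group) countable_carrier_of_rank:
  assumes "rank_at_most G r"
  shows "countable (carrier G)"
proof -
  obtain S where S: "S \<subseteq> carrier G" "finite S" "generate G S = carrier G"
    using assms by (auto simp: rank_at_most_def)
  let ?T = "S \<union> m_inv G ` S"
  have T: "?T \<subseteq> carrier G" using S(1) by auto
  define w where "w = (\<lambda>xs. foldr (\<otimes>) xs \<one>)"
  have w_closed: "w xs \<in> carrier G" if "xs \<in> lists ?T" for xs
    using that by (induction xs) (use T in \<open>auto simp: w_def\<close>)
  have w_append: "w (xs @ ys) = w xs \<otimes> w ys" if "xs \<in> lists ?T" "ys \<in> lists ?T" for xs ys
    using that(1)
  proof induction
    case Nil
    then show ?case using w_closed[OF that(2)] by (simp add: w_def)
  next
    case (Cons x xs)
    have "w (x # zs) = x \<otimes> w zs" for zs by (simp add: w_def)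
    moreover have "x \<in> carrier G" using Cons T by blast
    ultimately show ?case
      using Cons w_closed[OF that(2)] w_closed[of xs] by (simp add: m_assoc)
  qed
  have single: "s \<in> w ` lists ?T" if "s \<in> ?T" for s
  proof
    show "s = w [s]" using that T by (auto simp: w_def)
    show "[s] \<in> lists ?T" using that by simp
  qed
  have "g \<in> w ` lists ?T" if "g \<in> generate G S" for g
    using that
  proof induction
    case one
    have "w [] = \<one>" by (simp add: w_def)
    then show ?case by (metis image_eqI lists.Nil)
  next
    case (eng g h)
    then obtain xs ys where "g = w xs" "h = w ys" "xs \<in> lists ?T" "ys \<in> lists ?T" by blast
    then show ?case by (metis w_append append_in_lists_conv image_eqI)
  qed (use single in blast)+
  then have "carrier G \<subseteq> w ` lists ?T" using S(3) by blast
  moreover have "countable (lists ?T)" using S(2) by (simp add: countable_finite)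
  ultimately show ?thesis by (meson countable_image countable_subset)
qed

section \<open>Invariance under group isomorphisms\<close>

lemma replicate_pmf_map_pmf:
  "replicate_pmf n (map_pmf f p) = map_pmf (map f) (replicate_pmf n p)"
  by (induction n) (simp_all add: map_bind_pmf bind_map_pmf)

context group_hom
begin

lemma image_lcoset:
  assumes "x \<in> carrier G" "K \<subseteq> carrier G"
  shows "h ` (x <#\<^bsub>G\<^esub> K) = h x <#\<^bsub>H\<^esub> h ` K"
  using assms by (force simp: l_coset_def)

lemma hom_simple_commutator:
  "xs \<noteq> [] \<Longrightarrow> set xs \<subseteq> carrier G \<Longrightarrow> simple_commutator H (map h xs) = h (simple_commutator G xs)"
proof (induction xs rule: rev_induct)
  case (snoc x xs)
  then show ?case
    using G.simple_commutator_closed[of xs]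
    by (cases "xs = []") (simp_all add: simple_commutator_snoc hom_commutator, simp add: simple_commutator_def)
qed simp

lemma rank_at_most_image:
  assumes "rank_at_most G r" "h ` carrier G = carrier H"
  shows "rank_at_most H r"
proof -
  obtain S where S: "S \<subseteq> carrier G" "finite S" "card S \<le> r" "generate G S = carrier G"
    using assms by (auto simp: rank_at_most_def)
  have "generate H (h ` S) = carrier H" using generate_img[OF S(1)] S(4) assms(2) by simp
  then show ?thesis
    using S card_image_le[OF S(2), of h] unfolding rank_at_most_def
    by (intro exI[of _ "h ` S"]) auto
qed

end

locale group_iso = group_hom +
  assumes bij: "bij_betw h (carrier G) (carrier H)"
begin

lemma inj: "inj_on h (carrier G)" and surj: "h ` carrier G = carrier H"
  using bij by (auto simp: bij_betw_def)

lemma lcosets_image: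
  assumes "K \<subseteq> carrier G"
  shows "lcosets\<^bsub>H\<^esub> (h ` K) = (image h) ` (lcosets\<^bsub>G\<^esub> K)"
proof -
  have "lcosets\<^bsub>H\<^esub> (h ` K) = (\<lambda>x. h x <#\<^bsub>H\<^esub> h ` K) ` carrier G"
    by (simp add: lcosets_eq_image image_image flip: surj)
  also have "\<dots> = (\<lambda>x. h ` (x <#\<^bsub>G\<^esub> K)) ` carrier G"
    using image_lcoset[OF _ assms] by (intro image_cong) auto
  finally show ?thesis by (simp add: lcosets_eq_image image_image)
qed

lemma inj_on_lcosets:
  assumes "K \<subseteq> carrier G"
  shows "inj_on (image h) (lcosets\<^bsub>G\<^esub> K)"
  by (rule inj_on_subset[OF inj_on_image_Pow[OF inj]])
    (use assms in \<open>auto simp: lcosets_eq_image l_coset_def\<close>)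

lemma group_index_image: "K \<subseteq> carrier G \<Longrightarrow> group_index H (h ` K) = group_index G K"
  unfolding group_index_def by (simp add: lcosets_image card_image inj_on_lcosets)

lemma finite_index_image: "K \<subseteq> carrier G \<Longrightarrow> finite_index H (h ` K) \<longleftrightarrow> finite_index G K"
  unfolding finite_index_def by (simp add: lcosets_image finite_image_iff inj_on_lcosets)

text \<open>The subgroup \<open>K\<close> is the image of \<open>K'\<close> under the inverse
  isomorphism. Uniform measurement of index in the target concerns all of its subgroups, so each has
  to be pulled back.\<close>

lemma subgroup_eq_image:
  assumes "subgroup K' H"
  obtains K where "subgroup K G" "K' = h ` K"
proof
  interpret inv: group_hom H G "inv_into (carrier G) h"
    by unfold_locales (use G.iso_set_sym[of h H] bij homh in \<open>auto simp: iso_def\<close>)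
  show "subgroup (inv_into (carrier G) h ` K') G"
    using assms by (rule inv.subgroup_img_is_subgroup)
  have "K' \<subseteq> h ` carrier G" using subgroup.subset[OF assms] surj by simp
  then show "K' = h ` (inv_into (carrier G) h ` K')"
    by (force simp: image_image f_inv_into_f)
qed

text \<open>Injectivity of \<open>h\<close> is known on the carrier only, so the preimage of the
  image of \<open>A\<close> may exceed \<open>A\<close>, but not within the support of
  \<open>p\<close>.\<close>

lemma measure_map_pmf_image:
  assumes "set_pmf p \<subseteq> carrier G" "A \<subseteq> carrier G"
  shows "measure_pmf.prob (map_pmf h p) (h ` A) = measure_pmf.prob p A"
  unfolding measure_map_pmf
  by (rule measure_pmf.finite_measure_eq_AE)
    (use assms inj in \<open>auto simp: AE_measure_pmf_iff inj_on_def subset_iff\<close>)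

lemma measures_index_uniformly_map_pmf:
  assumes "measures_index_uniformly G M" "\<And>n. prob_measure_on G (M n)"
  shows "measures_index_uniformly H (\<lambda>n. map_pmf h (M n))"
  unfolding measures_index_uniformly_def
proof (rule uniform_limitI)
  fix e :: real assume "e > 0"
  from uniform_limitD[OF assms(1)[unfolded measures_index_uniformly_def] this]
  show "\<forall>\<^sub>F n in sequentially. \<forall>z\<in>{(x, K). x \<in> carrier H \<and> subgroup K H}.
    dist (case z of (x, K) \<Rightarrow> measure_pmf.prob (map_pmf h (M n)) (x <#\<^bsub>H\<^esub> K))
      (case z of (x, K) \<Rightarrow> 1 / real (group_index H K)) < e"
  proof eventually_elim
    case (elim n)
    have "dist (measure_pmf.prob (map_pmf h (M n)) (x' <#\<^bsub>H\<^esub> K')) (1 / real (group_index H K')) < e"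
      if "x' \<in> carrier H" "subgroup K' H" for x' K'
    proof -
      from subgroup_eq_image[OF that(2)] obtain K where K: "subgroup K G" "K' = h ` K" .
      from that(1) surj obtain x where x: "x \<in> carrier G" "x' = h x" by blast
      have KG: "K \<subseteq> carrier G" using subgroup.subset[OF K(1)] .
      have "measure_pmf.prob (map_pmf h (M n)) (x' <#\<^bsub>H\<^esub> K') = measure_pmf.prob (M n) (x <#\<^bsub>G\<^esub> K)"
        unfolding x(2) K(2) image_lcoset[OF x(1) KG, symmetric]
        by (rule measure_map_pmf_image[OF _ G.l_coset_subset_G[OF KG x(1)]])
          (rule assms(2)[unfolded prob_measure_on_def])
      moreover have "group_index H K' = group_index G K" using group_index_image[OF KG] K(2) by simp
      ultimately show ?thesis using elim x(1) K(1) by auto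
    qed
    then show ?case by auto
  qed
qed

text \<open>Sampled tuples have entries in the carrier, where \<open>h\<close> is injective, so the
  two events agree almost surely.\<close>

lemma commutator_prob_map_pmf:
  assumes "prob_measure_on G p" "g \<in> carrier G"
  shows "commutator_prob k (map_pmf h p) H (h g) = commutator_prob k p G g"
  unfolding commutator_prob_def replicate_pmf_map_pmf measure_map_pmf
proof (rule measure_pmf.finite_measure_eq_AE)
  show "AE xs in measure_pmf (replicate_pmf (k + 1) p).
    xs \<in> map h -` {xs. simple_commutator H xs = h g} \<longleftrightarrow> xs \<in> {xs. simple_commutator G xs = g}"
    unfolding AE_measure_pmf_iff
  proof
    fix xs assume "xs \<in> set_pmf (replicate_pmf (k + 1) p)"
    then have "xs \<noteq> []" "set xs \<subseteq> set_pmf p" by (auto simp: set_replicate_pmf)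
    then have xs: "xs \<noteq> []" "set xs \<subseteq> carrier G" using assms(1) by (auto simp: prob_measure_on_def)
    then show "xs \<in> map h -` {xs. simple_commutator H xs = h g} \<longleftrightarrow> xs \<in> {xs. simple_commutator G xs = g}"
      using hom_simple_commutator[OF xs] inj_on_eq_iff[OF inj G.simple_commutator_closed[OF xs] assms(2)]
      by simp
  qed
qed auto

lemma step_nilpotent_image_iff:
  assumes "subgroup K G"
  shows "step_nilpotent k (H\<lparr>carrier := h ` K\<rparr>) \<longleftrightarrow> step_nilpotent k (G\<lparr>carrier := K\<rparr>)"
proof -
  have KG: "K \<subseteq> carrier G" using subgroup.subset[OF assms] .
  have iff: "simple_commutator H (map h xs) = \<one>\<^bsub>H\<^esub> \<longleftrightarrow> simple_commutator G xs = \<one>\<^bsub>G\<^esub>"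
    if "length xs = k + 1" "set xs \<subseteq> K" for xs
  proof -
    have xs: "xs \<noteq> []" "set xs \<subseteq> carrier G" using that KG by auto
    show ?thesis
      using hom_simple_commutator[OF xs] inj_on_eq_iff[OF inj G.simple_commutator_closed[OF xs] G.one_closed]
      by simp
  qed
  have "(\<forall>ys. length ys = k + 1 \<and> set ys \<subseteq> h ` K \<longrightarrow> simple_commutator H ys = \<one>\<^bsub>H\<^esub>) \<longleftrightarrow>
    (\<forall>xs. length xs = k + 1 \<and> set xs \<subseteq> K \<longrightarrow> simple_commutator G xs = \<one>\<^bsub>G\<^esub>)" (is "?l \<longleftrightarrow> ?r")
  proof
    assume ?l
    show ?r
    proof (intro allI impI)
      fix xs assume xs: "length xs = k + 1 \<and> set xs \<subseteq> K"
      then have "simple_commutator H (map h xs) = \<one>\<^bsub>H\<^esub>" using \<open>?l\<close> by (simp add: image_mono)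
      then show "simple_commutator G xs = \<one>\<^bsub>G\<^esub>" using iff xs by blast
    qed
  next
    assume ?r
    show ?l
    proof (intro allI impI)
      fix ys assume ys: "length ys = k + 1 \<and> set ys \<subseteq> h ` K"
      then have "ys \<in> lists (h ` K)" by auto
      then obtain xs where xs: "xs \<in> lists K" "ys = map h xs" unfolding lists_image by blast
      then have "length xs = k + 1" "set xs \<subseteq> K" using ys by auto
      then show "simple_commutator H ys = \<one>\<^bsub>H\<^esub>" using iff \<open>?r\<close> xs(2) by blast
    qed
  qed
  then show ?thesis
    by (simp only: G.step_nilpotent_subgroup_iff[OF assms]
        H.step_nilpotent_subgroup_iff[OF subgroup_img_is_subgroup[OF assms]])
qed

end

text \<open>A group of finite rank is countable, so it has an isomorphic copy on a set of natural
  numbers. The measures and \<open>g\<close> are pushed forward to the copy, and the subgroup found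
  there is pulled back with the same index.\<close>

lemma nilpotent_index_bound_transfer:
  assumes "nilpotent_index_bound TYPE(nat) r k \<alpha> C"
  shows "nilpotent_index_bound TYPE('a) r k \<alpha> C"
  unfolding nilpotent_index_bound_def
proof (intro allI impI)
  fix G :: "'a monoid" and M g
  assume *: "group G \<and> rank_at_most G r \<and>
        (\<forall>n. prob_measure_on G (M n)) \<and> measures_index_uniformly G M \<and>
        g \<in> carrier G \<and> limsup_commutator_prob k M G g \<ge> ereal \<alpha>"
  then interpret group G by simp
  obtain f :: "'a \<Rightarrow> nat" where f: "inj_on f (carrier G)"
    using countable_carrier_of_rank * unfolding countable_def by blast
  \<comment> \<open>\<open>image_group f G\<close> is the group structure carried over by
    \<open>f\<close> to the image of the carrier.\<close>
  define G' where "G' = image_group f G"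
  have iso: "f \<in> iso G G'" unfolding G'_def by (rule inj_imp_image_group_iso[OF f])
  interpret G': group G' unfolding G'_def by (rule inj_imp_image_group_is_group[OF f])
  interpret group_iso G G' f
    by unfold_locales (use iso in \<open>auto simp: iso_def\<close>)
  have "limsup_commutator_prob k (\<lambda>n. map_pmf f (M n)) G' (f g) = limsup_commutator_prob k M G g"
    using * commutator_prob_map_pmf by (simp add: limsup_commutator_prob_def)
  moreover have "prob_measure_on G' (map_pmf f (M n))" for n
    using * surj unfolding prob_measure_on_def set_map_pmf by (metis image_mono)
  moreover have "rank_at_most G' r" using * rank_at_most_image surj by blast
  moreover have "measures_index_uniformly G' (\<lambda>n. map_pmf f (M n))"
    using * measures_index_uniformly_map_pmf by blast
  ultimately have "\<exists>K'. subgroup K' G' \<and> step_nilpotent k (G'\<lparr>carrier := K'\<rparr>) \<and>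
      finite_index G' K' \<and> group_index G' K' \<le> C"
    using assms[unfolded nilpotent_index_bound_def, rule_format, of G' "\<lambda>n. map_pmf f (M n)" "f g"]
      * G'.is_group by auto
  then obtain K' where K': "subgroup K' G'" "step_nilpotent k (G'\<lparr>carrier := K'\<rparr>)"
      "finite_index G' K'" "group_index G' K' \<le> C" by blast
  obtain K where K: "subgroup K G" "K' = f ` K" using subgroup_eq_image[OF K'(1)] .
  then show "\<exists>H. subgroup H G \<and> step_nilpotent k (G\<lparr>carrier := H\<rparr>) \<and>
             finite_index G H \<and> group_index G H \<le> C"
    using K' step_nilpotent_image_iff[OF K(1)] finite_index_image group_index_image
      subgroup.subset[OF K(1)] by auto
qed

text \<open>The witness is \<open>nilpotency_bound r k (\<alpha> / 2)\<close>. The second conjunct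
  holds for every constant valid over \<open>nat\<close>, by invariance under isomorphism.\<close>

theorem corollary1p8:
  fixes r k :: nat and \<alpha> :: real
  assumes "\<alpha> > 0"
  shows "(\<exists>C. nilpotent_index_bound TYPE(nat) r k \<alpha> C) \<and>
         (\<forall>C. nilpotent_index_bound TYPE(nat) r k \<alpha> C \<longrightarrow> nilpotent_index_bound TYPE('a) r k \<alpha> C)"
  using nilpotent_index_bound_nilpotency_bound[OF assms] nilpotent_index_bound_transfer by blast

end
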